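(* For every semiring $\mathcal{S}$ and every $m\in\mathbb{N}$, the bijection game $BG_m$ is sound for $\equiv_m$ on $\mathcal{S}$: for all model-defining $\mathcal{S}$-interpretations $\pi_A,\pi_B$ (with finite universes, same finite relational vocabulary), if Duplicator has a winning strategy in $BG_m(\pi_A,\pi_B)$ then $\pi_A\equiv_m\pi_B$.
   Context: A semiring is a structure $\mathcal{S}=(S,+,\cdot,0,1)$ with $0\neq 1$, commutative monoids $(S,+,0)$, $(S,\cdot,1)$, distributivity, $0\cdot s=0$, naturally ordered ($s\le t:\Leftrightarrow\exists r\,(s+r=t)$ is a partial order). For a finite relational vocabulary $\tau$ and universe $A$, $\mathrm{Lit}_A(\tau)$ is the set of literals $R\bar a,\neg R\bar a$ ($R\in\tau$, $\bar a$ from $A$); an $\mathcal{S}$-interpretation is $\pi:\mathrm{Lit}_A(\tau)\to S$, model-defining if for each atom $R\bar a$ exactly one of $\pi(R\bar a),\pi(\neg R\bar a)$ is $0$. Formulae in negation normal form are evaluated by: equalities/inequalities by their truth value ($1$ or $0$), literals by $\pi$, $\vee,\exists$ by sums, $\wedge,\forall$ by products over the universe. $\pi_A\equiv_m\pi_B$ means all sentences of quantifier rank $\le m$ have equal values. The game $BG_m(\pi_A,\bar a,\pi_B,\bar b)$: in each of $m$ rounds Duplicator must provide a bijection $h:A\to B$ (if $|A|\ne|B|$ Spoiler wins immediately), then Spoiler picks $a\in A$ and the pair $(a,h(a))$ is appended to the current tuples. Duplicator wins iff the final map $\bar a'\mapsto\bar b'$ is a local isomorphism: $a'_i=a'_j\Leftrightarrow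 b'_i=b'_j$ and $\pi_A(L(\bar a'))=\pi_B(L(\bar b'))$ for every literal $L(\bar x)$ over $\tau$ in the variables $x_1,\dots,x_k$ ($k$ the tuple length). *)

theory Defs
  imports Main
begin

text \<open>
  A relational vocabulary is a set \<open>\<tau>\<close> of relation symbols with an arity function \<open>ar\<close>.
  The second type parameter of a literal is the type of its arguments: elements of a universe
  for instantiated literals, variables for literals occurring in formulae.  The instantiation
  of a literal under an assignment \<open>v\<close> is \<open>map_literal id v\<close>.
\<close>

datatype ('r, 'x) literal = Pos 'r "'x list" | Neg 'r "'x list"

definition Lit :: "'r set \<Rightarrow> ('r \<Rightarrow> nat) \<Rightarrow> 'x set \<Rightarrow> ('r, 'x) literal set" where
  "Lit \<tau> ar X =
     {Pos R xs | R xs. R \<in> \<tau> \<and> length xs = ar R \<and> set xs \<subseteq> X} \<union>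
     {Neg R xs | R xs. R \<in> \<tau> \<and> length xs = ar R \<and> set xs \<subseteq> X}"

text \<open>
  An interpretation with universe \<open>A\<close> is a function on literals of which only the values on
  \<open>Lit \<tau> ar A\<close> are relevant.
\<close>

definition model_defining ::
  "'r set \<Rightarrow> ('r \<Rightarrow> nat) \<Rightarrow> 'a set \<Rightarrow> (('r, 'a) literal \<Rightarrow> 's::zero) \<Rightarrow> bool" where
  "model_defining \<tau> ar A \<pi> \<longleftrightarrow>
     (\<forall>R\<in>\<tau>. \<forall>as. length as = ar R \<and> set as \<subseteq> A \<longrightarrow>
        (\<pi> (Pos R as) = 0) \<noteq> (\<pi> (Neg R as) = 0))"

datatype 'r fm =
    FLit "('r, nat) literal"
  | FEq nat nat
  | FNeq nat nat
  | FOr "'r fm" "'r fm"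
  | FAnd "'r fm" "'r fm"
  | FEx nat "'r fm"
  | FAll nat "'r fm"

primrec fm_over :: "'r set \<Rightarrow> ('r \<Rightarrow> nat) \<Rightarrow> 'r fm \<Rightarrow> bool" where
  "fm_over \<tau> ar (FLit L) \<longleftrightarrow> L \<in> Lit \<tau> ar UNIV"
| "fm_over \<tau> ar (FEq x y) \<longleftrightarrow> True"
| "fm_over \<tau> ar (FNeq x y) \<longleftrightarrow> True"
| "fm_over \<tau> ar (FOr \<phi> \<psi>) \<longleftrightarrow> fm_over \<tau> ar \<phi> \<and> fm_over \<tau> ar \<psi>"
| "fm_over \<tau> ar (FAnd \<phi> \<psi>) \<longleftrightarrow> fm_over \<tau> ar \<phi> \<and> fm_over \<tau> ar \<psi>"
| "fm_over \<tau> ar (FEx x \<phi>) \<longleftrightarrow> fm_over \<tau> ar \<phi>"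
| "fm_over \<tau> ar (FAll x \<phi>) \<longleftrightarrow> fm_over \<tau> ar \<phi>"

primrec free_vars :: "'r fm \<Rightarrow> nat set" where
  "free_vars (FLit L) = set2_literal L"
| "free_vars (FEq x y) = {x, y}"
| "free_vars (FNeq x y) = {x, y}"
| "free_vars (FOr \<phi> \<psi>) = free_vars \<phi> \<union> free_vars \<psi>"
| "free_vars (FAnd \<phi> \<psi>) = free_vars \<phi> \<union> free_vars \<psi>"
| "free_vars (FEx x \<phi>) = free_vars \<phi> - {x}"
| "free_vars (FAll x \<phi>) = free_vars \<phi> - {x}"

primrec qrank :: "'r fm \<Rightarrow> nat" where
  "qrank (FLit L) = 0"
| "qrank (FEq x y) = 0"
| "qrank (FNeq x y) = 0"
| "qrank (FOr \<phi> \<psi>) = max (qrank \<phi>) (qrank \<psi>)"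
| "qrank (FAnd \<phi> \<psi>) = max (qrank \<phi>) (qrank \<psi>)"
| "qrank (FEx x \<phi>) = Suc (qrank \<phi>)"
| "qrank (FAll x \<phi>) = Suc (qrank \<phi>)"

definition sentence :: "'r set \<Rightarrow> ('r \<Rightarrow> nat) \<Rightarrow> 'r fm \<Rightarrow> bool" where
  "sentence \<tau> ar \<phi> \<longleftrightarrow> fm_over \<tau> ar \<phi> \<and> free_vars \<phi> = {}"

primrec eval ::
  "'a set \<Rightarrow> (('r, 'a) literal \<Rightarrow> 's::comm_semiring_1) \<Rightarrow> (nat \<Rightarrow> 'a) \<Rightarrow> 'r fm \<Rightarrow> 's" where
  "eval A \<pi> v (FLit L) = \<pi> (map_literal id v L)"
| "eval A \<pi> v (FEq x y) = (if v x = v y then 1 else 0)"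
| "eval A \<pi> v (FNeq x y) = (if v x \<noteq> v y then 1 else 0)"
| "eval A \<pi> v (FOr \<phi> \<psi>) = eval A \<pi> v \<phi> + eval A \<pi> v \<psi>"
| "eval A \<pi> v (FAnd \<phi> \<psi>) = eval A \<pi> v \<phi> * eval A \<pi> v \<psi>"
| "eval A \<pi> v (FEx x \<phi>) = (\<Sum>a\<in>A. eval A \<pi> (v(x := a)) \<phi>)"
| "eval A \<pi> v (FAll x \<phi>) = (\<Prod>a\<in>A. eval A \<pi> (v(x := a)) \<phi>)"

lemma eval_cong_free_vars:
  assumes "\<And>x. x \<in> free_vars \<phi> \<Longrightarrow> v x = w x"
  shows "eval A \<pi> v \<phi> = eval A \<pi> w \<phi>"
  using assms
proof (induction \<phi> arbitrary: v w)
  case (FLit L)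
  then have "map_literal id v L = map_literal id w L"
    by (intro literal.map_cong) auto
  then show ?case by simp
next
  case (FOr \<phi> \<psi>)
  have "eval A \<pi> v \<phi> = eval A \<pi> w \<phi>"
    using FOr.prems by (intro FOr.IH(1)) auto
  moreover have "eval A \<pi> v \<psi> = eval A \<pi> w \<psi>"
    using FOr.prems by (intro FOr.IH(2)) auto
  ultimately show ?case by simp
next
  case (FAnd \<phi> \<psi>)
  have "eval A \<pi> v \<phi> = eval A \<pi> w \<phi>"
    using FAnd.prems by (intro FAnd.IH(1)) auto
  moreover have "eval A \<pi> v \<psi> = eval A \<pi> w \<psi>"
    using FAnd.prems by (intro FAnd.IH(2)) auto
  ultimately show ?case by simp
next
  case (FEx x \<phi>)
  have "eval A \<pi> (v(x := a)) \<phi> = eval A \<pi> (w(x := a)) \<phi>" for a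
    using FEx.prems by (intro FEx.IH) auto
  then show ?case by simp
next
  case (FAll x \<phi>)
  have "eval A \<pi> (v(x := a)) \<phi> = eval A \<pi> (w(x := a)) \<phi>" for a
    using FAll.prems by (intro FAll.IH) auto
  then show ?case by simp
qed simp_all

text \<open>
  The value of a sentence does not depend on the assignment, by \<open>eval_cong_free_vars\<close>, so an
  arbitrary one is used.
\<close>

definition sentence_value ::
  "'a set \<Rightarrow> (('r, 'a) literal \<Rightarrow> 's::comm_semiring_1) \<Rightarrow> 'r fm \<Rightarrow> 's" where
  "sentence_value A \<pi> \<phi> = eval A \<pi> (\<lambda>_. undefined) \<phi>"

definition equiv_upto ::
  "'r set \<Rightarrow> ('r \<Rightarrow> nat) \<Rightarrow> nat \<Rightarrow>
   'a set \<Rightarrow> (('r, 'a) literal \<Rightarrow> 's::comm_semiring_1) \<Rightarrow>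
   'b set \<Rightarrow> (('r, 'b) literal \<Rightarrow> 's) \<Rightarrow> bool" where
  "equiv_upto \<tau> ar m A \<pi>A B \<pi>B \<longleftrightarrow>
     (\<forall>\<phi>. sentence \<tau> ar \<phi> \<and> qrank \<phi> \<le> m \<longrightarrow>
        sentence_value A \<pi>A \<phi> = sentence_value B \<pi>B \<phi>)"

text \<open>The literals \<open>L\<close> have variables \<open>0, \<dots>, k - 1\<close>, standing for \<open>x\<^sub>1, \<dots>, x\<^sub>k\<close>.\<close>

definition local_iso ::
  "'r set \<Rightarrow> ('r \<Rightarrow> nat) \<Rightarrow> (('r, 'a) literal \<Rightarrow> 's) \<Rightarrow> 'a list \<Rightarrow>
   (('r, 'b) literal \<Rightarrow> 's) \<Rightarrow> 'b list \<Rightarrow> bool" where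
  "local_iso \<tau> ar \<pi>A as \<pi>B bs \<longleftrightarrow>
     length as = length bs \<and>
     (\<forall>i<length as. \<forall>j<length as. as ! i = as ! j \<longleftrightarrow> bs ! i = bs ! j) \<and>
     (\<forall>L\<in>Lit \<tau> ar {..<length as}.
        \<pi>A (map_literal id ((!) as) L) = \<pi>B (map_literal id ((!) bs) L))"

text \<open>
  A strategy of Duplicator assigns to each position (the current pair of tuples) the map she
  provides there; \<open>play \<sigma> as bs cs\<close> is the position reached from \<open>(as, bs)\<close> when she plays
  according to \<open>\<sigma>\<close> and Spoiler successively picks the elements of \<open>cs\<close>.
\<close>

type_synonym ('a, 'b) strategy = "'a list \<times> 'b list \<Rightarrow> 'a \<Rightarrow> 'b"

primrec play ::
  "('a, 'b) strategy \<Rightarrow> 'a list \<times> 'b list \<Rightarrow> 'a list \<Rightarrow> 'a list \<times> 'b list" where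
  "play \<sigma> p [] = p"
| "play \<sigma> p (c # cs) = play \<sigma> (fst p @ [c], snd p @ [\<sigma> p c]) cs"

text \<open>
  If \<open>card A \<noteq> card B\<close> there is no bijection to provide, so Duplicator loses in the first
  round.
\<close>

definition winning_strategy ::
  "'r set \<Rightarrow> ('r \<Rightarrow> nat) \<Rightarrow> nat \<Rightarrow>
   'a set \<Rightarrow> (('r, 'a) literal \<Rightarrow> 's) \<Rightarrow> 'a list \<Rightarrow>
   'b set \<Rightarrow> (('r, 'b) literal \<Rightarrow> 's) \<Rightarrow> 'b list \<Rightarrow> ('a, 'b) strategy \<Rightarrow> bool" where
  "winning_strategy \<tau> ar m A \<pi>A as B \<pi>B bs \<sigma> \<longleftrightarrow>
     (\<forall>cs. set cs \<subseteq> A \<and> length cs < m \<longrightarrow>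
        bij_betw (\<sigma> (play \<sigma> (as, bs) cs)) A B) \<and>
     (\<forall>cs. set cs \<subseteq> A \<and> length cs = m \<longrightarrow>
        (case play \<sigma> (as, bs) cs of (as', bs') \<Rightarrow> local_iso \<tau> ar \<pi>A as' \<pi>B bs'))"

definition duplicator_wins_BG ::
  "'r set \<Rightarrow> ('r \<Rightarrow> nat) \<Rightarrow> nat \<Rightarrow>
   'a set \<Rightarrow> (('r, 'a) literal \<Rightarrow> 's) \<Rightarrow> 'a list \<Rightarrow>
   'b set \<Rightarrow> (('r, 'b) literal \<Rightarrow> 's) \<Rightarrow> 'b list \<Rightarrow> bool" where
  "duplicator_wins_BG \<tau> ar m A \<pi>A as B \<pi>B bs \<longleftrightarrow>
     (\<exists>\<sigma>. winning_strategy \<tau> ar m A \<pi>A as B \<pi>B bs \<sigma>)"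

end

theory Submission
  imports Defs
begin

text \<open>
  Along positions won by Duplicator, a formula has the same value on both sides under assignments
  that read their values off the two tuples at the same indices.  At a quantifier, Duplicator's
  bijection matches the summands (or factors) on both sides.  The atomic case may be
  reached with rounds left to play; as the universe is nonempty these can be played out, and a
  local isomorphism restricts to initial segments of the tuples.
\<close>

lemma map_literal_in_Lit:
  assumes "L \<in> Lit \<tau> ar X" and "\<And>x. x \<in> set2_literal L \<Longrightarrow> f x \<in> Y"
  shows "map_literal id f L \<in> Lit \<tau> ar Y"
  using assms by (cases L) (auto simp: Lit_def)

lemma set2_literal_Lit: "L \<in> Lit \<tau> ar X \<Longrightarrow> set2_literal L \<subseteq> X"
  by (auto simp: Lit_def)

lemma Lit_mono: "X \<subseteq> Y \<Longrightarrow> Lit \<tau> ar X \<subseteq> Lit \<tau> ar Y"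
  by (auto simp: Lit_def)

text \<open>Equality tests and literals for the shorter tuples mention only indices below
  \<open>length as\<close>, where appending \<open>a\<close> and \<open>b\<close> changes no
  entry.\<close>

lemma local_iso_butlast:
  assumes "local_iso \<tau> ar \<pi>A (as @ [a]) \<pi>B (bs @ [b])"
  shows "local_iso \<tau> ar \<pi>A as \<pi>B bs"
proof -
  have len: "length as = length bs"
    and inj: "\<And>i j. i < Suc (length as) \<Longrightarrow> j < Suc (length as) \<Longrightarrow>
      (as @ [a]) ! i = (as @ [a]) ! j \<longleftrightarrow> (bs @ [b]) ! i = (bs @ [b]) ! j"
    and lit: "\<And>L. L \<in> Lit \<tau> ar {..<Suc (length as)} \<Longrightarrow>
      \<pi>A (map_literal id ((!) (as @ [a])) L) = \<pi>B (map_literal id ((!) (bs @ [b])) L)"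
    using assms by (auto simp: local_iso_def)
  have "as ! i = as ! j \<longleftrightarrow> bs ! i = bs ! j" if "i < length as" "j < length as" for i j
    using inj[of i j] that len by (simp add: nth_append)
  moreover have "\<pi>A (map_literal id ((!) as) L) = \<pi>B (map_literal id ((!) bs) L)"
    if L: "L \<in> Lit \<tau> ar {..<length as}" for L
  proof -
    have "L \<in> Lit \<tau> ar {..<Suc (length as)}"
      using L Lit_mono[of "{..<length as}" "{..<Suc (length as)}"] by auto
    moreover have "map_literal id ((!) (as @ [a])) L = map_literal id ((!) as) L"
      using set2_literal_Lit[OF L] by (intro literal.map_cong) (auto simp: nth_append)
    moreover have "map_literal id ((!) (bs @ [b])) L = map_literal id ((!) bs) L"
      using set2_literal_Lit[OF L] len by (intro literal.map_cong) (auto simp: nth_append)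
    ultimately show ?thesis
      using lit[of L] by simp
  qed
  ultimately show ?thesis
    using len by (simp add: local_iso_def)
qed

text \<open>\<open>\<sigma>\<close> depends only on the position, so it can be kept unchanged after
  a round: picks \<open>cs\<close> from the extended position amount to picks \<open>a # cs\<close>
  from the original one.\<close>

lemma winning_strategy_Suc:
  assumes "winning_strategy \<tau> ar (Suc m) A \<pi>A as B \<pi>B bs \<sigma>"
  shows winning_strategy_bij_betw: "bij_betw (\<sigma> (as, bs)) A B"
    and winning_strategy_step: "a \<in> A \<Longrightarrow>
      winning_strategy \<tau> ar m A \<pi>A (as @ [a]) B \<pi>B (bs @ [\<sigma> (as, bs) a]) \<sigma>"
proof -
  have bij: "\<And>cs. set cs \<subseteq> A \<Longrightarrow> length cs < Suc m \<Longrightarrow>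
      bij_betw (\<sigma> (play \<sigma> (as, bs) cs)) A B"
    and iso: "\<And>cs. set cs \<subseteq> A \<Longrightarrow> length cs = Suc m \<Longrightarrow>
      (case play \<sigma> (as, bs) cs of (as', bs') \<Rightarrow> local_iso \<tau> ar \<pi>A as' \<pi>B bs')"
    using assms by (simp_all add: winning_strategy_def)
  show "bij_betw (\<sigma> (as, bs)) A B"
    using bij[of "[]"] by simp
  show "winning_strategy \<tau> ar m A \<pi>A (as @ [a]) B \<pi>B (bs @ [\<sigma> (as, bs) a]) \<sigma>" if "a \<in> A"
    unfolding winning_strategy_def
  proof (intro conjI allI impI; elim conjE)
    fix cs assume "set cs \<subseteq> A" "length cs < m"
    then show "bij_betw (\<sigma> (play \<sigma> (as @ [a], bs @ [\<sigma> (as, bs) a]) cs)) A B"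
      using bij[of "a # cs"] that by simp
  next
    fix cs assume "set cs \<subseteq> A" "length cs = m"
    then show "case play \<sigma> (as @ [a], bs @ [\<sigma> (as, bs) a]) cs of
        (as', bs') \<Rightarrow> local_iso \<tau> ar \<pi>A as' \<pi>B bs'"
      using iso[of "a # cs"] that by simp
  qed
qed

text \<open>The winning condition tests final positions only. An arbitrary element of
  \<open>A\<close> serves as Spoiler's pick in each remaining round, and the appended pairs are then
  dropped one by one.\<close>

lemma winning_strategy_local_iso:
  assumes "winning_strategy \<tau> ar m A \<pi>A as B \<pi>B bs \<sigma>" and "A \<noteq> {}"
  shows "local_iso \<tau> ar \<pi>A as \<pi>B bs"
  using assms(1)
proof (induction m arbitrary: as bs)
  case 0
  then show ?case by (simp add: winning_strategy_def)
next
  case (Suc m)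
  from \<open>A \<noteq> {}\<close> obtain a where "a \<in> A" by blast
  from Suc.IH[OF winning_strategy_step[OF Suc.prems this]] show ?case
    by (rule local_iso_butlast)
qed

text \<open>The index map \<open>f\<close> ties variables to tuple entries, so variables may share
  an entry and a variable bound again simply moves to a new one. Rounds, tuples, assignments and
  \<open>f\<close> vary in the induction because a quantifier changes them all.\<close>

lemma winning_strategy_eval_eq:
  fixes \<pi>A :: "('r, 'a) literal \<Rightarrow> 's::comm_semiring_1"
  assumes "winning_strategy \<tau> ar m A \<pi>A as B \<pi>B bs \<sigma>" and "A \<noteq> {}"
    and "fm_over \<tau> ar \<phi>" and "qrank \<phi> \<le> m"
    and "\<And>x. x \<in> free_vars \<phi> \<Longrightarrow> f x < length as \<and> v x = as ! f x \<and> w x = bs ! f x"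
  shows "eval A \<pi>A v \<phi> = eval B \<pi>B w \<phi>"
  using assms(1,3-)
proof (induction \<phi> arbitrary: m as bs v w f)
  case (FLit L)
  note iso = winning_strategy_local_iso[OF FLit.prems(1) \<open>A \<noteq> {}\<close>]
  \<comment> \<open>\<open>local_iso\<close> speaks of literals whose variables are tuple indices,
    so \<open>L\<close> is first renamed along \<open>f\<close>; looking up the entries then yields
    its instances under \<open>v\<close> and \<open>w\<close>.\<close>
  have "map_literal id f L \<in> Lit \<tau> ar {..<length as}"
    using FLit.prems(2,4) by (intro map_literal_in_Lit[of _ _ _ UNIV]) auto
  then have "\<pi>A (map_literal id ((!) as) (map_literal id f L)) =
      \<pi>B (map_literal id ((!) bs) (map_literal id f L))"
    using iso by (simp add: local_iso_def)
  moreover have "map_literal id v L = map_literal id ((!) as) (map_literal id f L)"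
    unfolding literal.map_comp using FLit.prems(4) by (intro literal.map_cong) auto
  moreover have "map_literal id w L = map_literal id ((!) bs) (map_literal id f L)"
    unfolding literal.map_comp using FLit.prems(4) by (intro literal.map_cong) auto
  ultimately show ?case by simp
next
  case (FEq x y)
  then show ?case
    using winning_strategy_local_iso[OF FEq.prems(1) \<open>A \<noteq> {}\<close>] by (simp add: local_iso_def)
next
  case (FNeq x y)
  then show ?case
    using winning_strategy_local_iso[OF FNeq.prems(1) \<open>A \<noteq> {}\<close>] by (simp add: local_iso_def)
next
  case (FOr \<phi> \<psi>)
  have "eval A \<pi>A v \<phi> = eval B \<pi>B w \<phi>"
    using FOr.prems by (intro FOr.IH(1)[OF FOr.prems(1), of f]) auto
  moreover have "eval A \<pi>A v \<psi> = eval B \<pi>B w \<psi>"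
    using FOr.prems by (intro FOr.IH(2)[OF FOr.prems(1), of f]) auto
  ultimately show ?case by simp
next
  case (FAnd \<phi> \<psi>)
  have "eval A \<pi>A v \<phi> = eval B \<pi>B w \<phi>"
    using FAnd.prems by (intro FAnd.IH(1)[OF FAnd.prems(1), of f]) auto
  moreover have "eval A \<pi>A v \<psi> = eval B \<pi>B w \<psi>"
    using FAnd.prems by (intro FAnd.IH(2)[OF FAnd.prems(1), of f]) auto
  ultimately show ?case by simp
next
  case (FEx x \<phi>)
  \<comment> \<open>The quantifier makes the rank positive, hence a round is left in which
    Duplicator provides a bijection.\<close>
  from FEx.prems(3) obtain n where m: "m = Suc n" and n: "qrank \<phi> \<le> n"
    by (cases m) auto
  note win = FEx.prems(1)[unfolded m]
  have len: "length as = length bs"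
    using winning_strategy_local_iso[OF win \<open>A \<noteq> {}\<close>] by (simp add: local_iso_def)
  \<comment> \<open>The new pair stands at index \<open>length as\<close> in both tuples, by
    \<open>len\<close>, so \<open>x\<close> is redirected there; the other free variables keep their
    old indices, whose entries are unchanged.\<close>
  have "eval A \<pi>A (v(x := a)) \<phi> = eval B \<pi>B (w(x := \<sigma> (as, bs) a)) \<phi>" if "a \<in> A" for a
    using FEx.prems(2,4) n len
    by (intro FEx.IH[OF winning_strategy_step[OF win that], of "f(x := length as)"])
      (auto simp: nth_append less_SucI)
  then have "eval A \<pi>A v (FEx x \<phi>) = (\<Sum>a\<in>A. eval B \<pi>B (w(x := \<sigma> (as, bs) a)) \<phi>)"
    by simp
  \<comment> \<open>As \<open>a\<close> runs through \<open>A\<close>, Duplicator's answer runs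
    through \<open>B\<close> exactly once.\<close>
  also have "\<dots> = eval B \<pi>B w (FEx x \<phi>)"
    using sum.reindex_bij_betw[OF winning_strategy_bij_betw[OF win]] by simp
  finally show ?case .
next
  case (FAll x \<phi>)
  from FAll.prems(3) obtain n where m: "m = Suc n" and n: "qrank \<phi> \<le> n"
    by (cases m) auto
  note win = FAll.prems(1)[unfolded m]
  have len: "length as = length bs"
    using winning_strategy_local_iso[OF win \<open>A \<noteq> {}\<close>] by (simp add: local_iso_def)
  have "eval A \<pi>A (v(x := a)) \<phi> = eval B \<pi>B (w(x := \<sigma> (as, bs) a)) \<phi>" if "a \<in> A" for a
    using FAll.prems(2,4) n len
    by (intro FAll.IH[OF winning_strategy_step[OF win that], of "f(x := length as)"])
      (auto simp: nth_append less_SucI)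
  then have "eval A \<pi>A v (FAll x \<phi>) = (\<Prod>a\<in>A. eval B \<pi>B (w(x := \<sigma> (as, bs) a)) \<phi>)"
    by simp
  \<comment> \<open>The same bijection now permutes factors, which commutativity of the product
    allows.\<close>
  also have "\<dots> = eval B \<pi>B w (FAll x \<phi>)"
    using prod.reindex_bij_betw[OF winning_strategy_bij_betw[OF win]] by simp
  finally show ?case .
qed

theorem theorem3p3:
  fixes \<tau> :: "'r set" and ar :: "'r \<Rightarrow> nat" and m :: nat
    and A :: "'a set" and B :: "'b set"
    and \<pi>A :: "('r, 'a) literal \<Rightarrow> 's::{comm_semiring_1, canonically_ordered_monoid_add}"
    and \<pi>B :: "('r, 'b) literal \<Rightarrow> 's"
  assumes "finite \<tau>"
    and "finite A" and "A \<noteq> {}"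
    and "finite B" and "B \<noteq> {}"
    and "model_defining \<tau> ar A \<pi>A"
    and "model_defining \<tau> ar B \<pi>B"
    and "duplicator_wins_BG \<tau> ar m A \<pi>A [] B \<pi>B []"
  shows "equiv_upto \<tau> ar m A \<pi>A B \<pi>B"
proof -
  obtain \<sigma> where "winning_strategy \<tau> ar m A \<pi>A [] B \<pi>B [] \<sigma>"
    using assms(8) by (auto simp: duplicator_wins_BG_def)
  \<comment> \<open>A sentence has no free variables, so the index condition is vacuous for the
    empty tuples, and the \<open>undefined\<close> assignments on both sides are admissible.\<close>
  from winning_strategy_eval_eq[OF this \<open>A \<noteq> {}\<close>] show ?thesis
    by (auto simp: equiv_upto_def sentence_def sentence_value_def)
qed

end
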